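(* Let $g$ be a global state, $p,q\in\mathcal{PV}$ and $\Gamma\subseteq\mathcal{A}$. If $\phi\in\{p,\ p\wedge q,\ \langle\langle\Gamma\rangle\rangle \mathrm{X}\, p,\ \langle\langle\Gamma\rangle\rangle \mathrm{G}\, p,\ \langle\langle\Gamma\rangle\rangle\, p\,\mathrm{U}\, q\}$, then the predicate $Model_{g,\phi}(\mathcal{V}_M)$ is positive monotonic with respect to the variables $VB$.
   Context: Fix a set of agents $\mathcal{A}=\{1,\dots,n\}$, a finite set $\mathcal{PV}$ of propositional variables, and for each agent $i$ a finite set of local states $L_i=\{l_i^1,\dots,l_i^{n_i}\}$. Agent $i$ has actions $Act_i=\{a_i^1,\dots,a_i^{n_i}\}$ and a local protocol $P_i:L_i\to 2^{Act_i}$ with $P_i(l)\neq\emptyset$ for all $l\in L_i$; its local transition function is $T_i(l_i^k,a_i^j)=l_i^j$, defined iff $a_i^j\in P_i(l_i^k)$. A model is $M=(St,T,V)$ with global states $St=L_1\times\dots\times L_n$, global actions $Act=Act_1\times\dots\times Act_n$, global transition function $T(g,a)=g'$ iff $T_i(g^i,a^i)=g'^i$ for all $i$ (where $g^i$, $a^i$ denote the $i$-th components), and valuation $V:St\to 2^{\mathcal{PV}}$. Encoding: $P_i$ is represented by a Boolean table of $n_i\times n_i$ entries (entry $(l,a)$ is $1$ iff $a\in P_i(l)$), flattened into a bit vector $tb_i$; $V$ is represented by a bit vector $vb$ of length $|St|\cdot|\mathcal{PV}|$ (entry $(g,p)$ is $1$ iff $p\in V(g)$). The model is encoded by $v_M=(tb_1,\dots,tb_n,vb)$,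 and $\mathcal{V}_M=(TB_1,\dots,TB_n,VB)$ denotes the corresponding vector of Boolean variables; only bit vectors encoding models (each local state has at least one available action) are considered. A path from $g$ is an infinite sequence $g_0a_0g_1a_1\dots$ with $g_0=g$ and $T(g_k,a_k)=g_{k+1}$ for all $k$; $\pi[k]=g_k$. A (memoryless perfect information) strategy of agent $i$ is a function $\sigma_i:St\to Act_i$ with $\sigma_i(g)\in P_i(g^i)$; a joint strategy $\sigma_\Gamma$ for $\Gamma\subseteq\mathcal{A}$ is a tuple of strategies of the agents in $\Gamma$. The outcome $out_M(g,\sigma_\Gamma)$ is the set of paths $g_0a_0g_1\dots$ from $g$ with $a_k^j=\sigma_j(g_k)$ for all $k$ and all $j\in\Gamma$. ATL formulae: $\varphi::=p\mid\neg\varphi\mid\varphi\wedge\varphi\mid\langle\langle\Gamma\rangle\rangle\mathrm{X}\varphi\mid\langle\langle\Gamma\rangle\rangle\varphi\mathrm{U}\varphi\mid\langle\langle\Gamma\rangle\rangle\mathrm{G}\varphi$. Semantics: $M,g\models p$ iff $p\in V(g)$; Boolean cases as usual; $M,g\models\langle\langle\Gamma\rangle\rangle\mathrm{X}\varphi$ iff there is $\sigma_\Gamma$ with $out_M(g,\sigma_\Gamma)\neq\emptyset$ and $M,\pi[1]\models\varphi$ for every $\pi\in out_M(g,\sigma_\Gamma)$; $M,g\models\langle\langle\Gamma\rangle\rangle\varphi_1\mathrm{U}\varphi_2$ iff there is $\sigma_\Gamma$ with nonempty outcome such that every $\pi$ in it has some $i\ge0$ with $M,\pi[i]\models\varphi_2$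 and $M,\pi[j]\models\varphi_1$ for all $j<i$; $M,g\models\langle\langle\Gamma\rangle\rangle\mathrm{G}\varphi$ iff there is $\sigma_\Gamma$ with nonempty outcome such that $M,\pi[i]\models\varphi$ for all $i\ge0$ and all $\pi$ in it. $Model_{g,\phi}(v_M)=1$ iff $M,g\models\phi$ for the model $M$ encoded by $v_M$. Monotonicity: a predicate on bit vectors is positive monotonic w.r.t. a set $W$ of its variables if changing any single variable of $W$ from $0$ to $1$ (others fixed) preserves the value $1$; it is negative monotonic w.r.t. $W$ if changing any single variable of $W$ from $1$ to $0$ preserves the value $1$. *)

theory Defs
  imports Main "HOL-Library.FuncSet"
begin

text \<open>
  The local state \<open>l\<^sub>i\<^sup>k\<close> and the action \<open>a\<^sub>i\<^sup>k\<close> are represented by the index \<open>k\<close>; tuples indexed by a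
  set are extensional functions on that set.
\<close>

record 'p signature =
  num_agents :: nat
  num_local :: "nat \<Rightarrow> nat"
  prop_vars :: "'p set"

type_synonym gstate = "nat \<Rightarrow> nat"
type_synonym gaction = "nat \<Rightarrow> nat"

definition agents :: "'p signature \<Rightarrow> nat set" where
  "agents S = {1..num_agents S}"

definition local_states :: "'p signature \<Rightarrow> nat \<Rightarrow> nat set" where
  "local_states S i = {1..num_local S i}"

definition local_actions :: "'p signature \<Rightarrow> nat \<Rightarrow> nat set" where
  "local_actions S i = {1..num_local S i}"

definition global_states :: "'p signature \<Rightarrow> gstate set" where
  "global_states S = (\<Pi>\<^sub>E i\<in>agents S. local_states S i)"

definition global_actions :: "'p signature \<Rightarrow> gaction set" where
  "global_actions S = (\<Pi>\<^sub>E i\<in>agents S. local_actions S i)"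

record 'p model =
  protocol :: "nat \<Rightarrow> nat \<Rightarrow> nat set"
  valuation :: "gstate \<Rightarrow> 'p set"

definition models :: "'p signature \<Rightarrow> 'p model set" where
  "models S = {M.
     protocol M \<in> (\<Pi>\<^sub>E i\<in>agents S. \<Pi>\<^sub>E l\<in>local_states S i. Pow (local_actions S i) - {{}}) \<and>
     valuation M \<in> global_states S \<rightarrow>\<^sub>E Pow (prop_vars S)}"

text \<open>The action with index \<open>j\<close> leads to the local state with the same index \<open>j\<close>.\<close>

definition local_trans :: "'p model \<Rightarrow> nat \<Rightarrow> nat \<Rightarrow> nat \<Rightarrow> nat option" where
  "local_trans M i l a = (if a \<in> protocol M i l then Some a else None)"

definition global_trans :: "'p signature \<Rightarrow> 'p model \<Rightarrow> gstate \<Rightarrow> gaction \<Rightarrow> gstate \<Rightarrow> bool" where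
  "global_trans S M g a g' \<longleftrightarrow>
     g \<in> global_states S \<and> a \<in> global_actions S \<and> g' \<in> global_states S \<and>
     (\<forall>i\<in>agents S. local_trans M i (g i) (a i) = Some (g' i))"

text \<open>The path \<open>g\<^sub>0 a\<^sub>0 g\<^sub>1 a\<^sub>1 \<dots>\<close> is the pair of the sequences \<open>(g\<^sub>k)\<close> and \<open>(a\<^sub>k)\<close>.\<close>

type_synonym path = "(nat \<Rightarrow> gstate) \<times> (nat \<Rightarrow> gaction)"

definition path_from :: "'p signature \<Rightarrow> 'p model \<Rightarrow> gstate \<Rightarrow> path \<Rightarrow> bool" where
  "path_from S M g \<pi> \<longleftrightarrow>
     fst \<pi> 0 = g \<and> (\<forall>k. global_trans S M (fst \<pi> k) (snd \<pi> k) (fst \<pi> (Suc k)))"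

definition joint_strategies ::
  "'p signature \<Rightarrow> 'p model \<Rightarrow> nat set \<Rightarrow> (nat \<Rightarrow> gstate \<Rightarrow> nat) set" where
  "joint_strategies S M \<Gamma> = (\<Pi>\<^sub>E i\<in>\<Gamma>. \<Pi>\<^sub>E g\<in>global_states S. protocol M i (g i))"

definition outcome ::
  "'p signature \<Rightarrow> 'p model \<Rightarrow> gstate \<Rightarrow> nat set \<Rightarrow> (nat \<Rightarrow> gstate \<Rightarrow> nat) \<Rightarrow> path set" where
  "outcome S M g \<Gamma> \<sigma> =
     {\<pi>. path_from S M g \<pi> \<and> (\<forall>k. \<forall>j\<in>\<Gamma>. snd \<pi> k j = \<sigma> j (fst \<pi> k))}"

datatype 'p atl =
    Prop 'p
  | Neg "'p atl"
  | Conj "'p atl" "'p atl"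
  | CoalX "nat set" "'p atl"
  | CoalU "nat set" "'p atl" "'p atl"
  | CoalG "nat set" "'p atl"

primrec sat :: "'p signature \<Rightarrow> 'p model \<Rightarrow> gstate \<Rightarrow> 'p atl \<Rightarrow> bool" where
  "sat S M g (Prop p) \<longleftrightarrow> p \<in> valuation M g"
| "sat S M g (Neg \<phi>) \<longleftrightarrow> \<not> sat S M g \<phi>"
| "sat S M g (Conj \<phi> \<psi>) \<longleftrightarrow> sat S M g \<phi> \<and> sat S M g \<psi>"
| "sat S M g (CoalX \<Gamma> \<phi>) \<longleftrightarrow>
     (\<exists>\<sigma>\<in>joint_strategies S M \<Gamma>. outcome S M g \<Gamma> \<sigma> \<noteq> {} \<and>
       (\<forall>\<pi>\<in>outcome S M g \<Gamma> \<sigma>. sat S M (fst \<pi> 1) \<phi>))"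
| "sat S M g (CoalU \<Gamma> \<phi> \<psi>) \<longleftrightarrow>
     (\<exists>\<sigma>\<in>joint_strategies S M \<Gamma>. outcome S M g \<Gamma> \<sigma> \<noteq> {} \<and>
       (\<forall>\<pi>\<in>outcome S M g \<Gamma> \<sigma>.
          \<exists>i. sat S M (fst \<pi> i) \<psi> \<and> (\<forall>j<i. sat S M (fst \<pi> j) \<phi>)))"
| "sat S M g (CoalG \<Gamma> \<phi>) \<longleftrightarrow>
     (\<exists>\<sigma>\<in>joint_strategies S M \<Gamma>. outcome S M g \<Gamma> \<sigma> \<noteq> {} \<and>
       (\<forall>\<pi>\<in>outcome S M g \<Gamma> \<sigma>. \<forall>i. sat S M (fst \<pi> i) \<phi>))"

text \<open>
  The positions of the bit vector \<open>(tb\<^sub>1, \<dots>, tb\<^sub>n, vb)\<close> are named rather than numbered: \<open>TBit i l a\<close> is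
  the entry \<open>(l, a)\<close> of the table of agent \<open>i\<close>, and \<open>VBit g p\<close> is the entry \<open>(g, p)\<close> of \<open>vb\<close>.
\<close>

datatype 'p bvar = TBit nat nat nat | VBit gstate 'p

definition TB :: "'p signature \<Rightarrow> nat \<Rightarrow> 'p bvar set" where
  "TB S i = {TBit i l a | l a. l \<in> local_states S i \<and> a \<in> local_actions S i}"

definition VB :: "'p signature \<Rightarrow> 'p bvar set" where
  "VB S = {VBit g p | g p. g \<in> global_states S \<and> p \<in> prop_vars S}"

definition model_vars :: "'p signature \<Rightarrow> 'p bvar set" where
  "model_vars S = (\<Union>i\<in>agents S. TB S i) \<union> VB S"

definition encode :: "'p signature \<Rightarrow> 'p model \<Rightarrow> 'p bvar \<Rightarrow> bool" where
  "encode S M = (\<lambda>x\<in>model_vars S.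
     case x of TBit i l a \<Rightarrow> a \<in> protocol M i l | VBit g p \<Rightarrow> p \<in> valuation M g)"

definition model_vectors :: "'p signature \<Rightarrow> ('p bvar \<Rightarrow> bool) set" where
  "model_vectors S = encode S ` models S"

definition model_of :: "'p signature \<Rightarrow> ('p bvar \<Rightarrow> bool) \<Rightarrow> 'p model" where
  "model_of S v = (THE M. M \<in> models S \<and> encode S M = v)"

definition Model :: "'p signature \<Rightarrow> gstate \<Rightarrow> 'p atl \<Rightarrow> ('p bvar \<Rightarrow> bool) \<Rightarrow> bool" where
  "Model S g \<phi> v \<longleftrightarrow> sat S (model_of S v) g \<phi>"

text \<open>\<open>D\<close> is the set of bit vectors under consideration, i.e. the domain of the predicate \<open>f\<close>.\<close>

definition positive_monotonic ::
  "('x \<Rightarrow> bool) set \<Rightarrow> 'x set \<Rightarrow> (('x \<Rightarrow> bool) \<Rightarrow> bool) \<Rightarrow> bool" where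
  "positive_monotonic D W f \<longleftrightarrow>
     (\<forall>v\<in>D. \<forall>x\<in>W. \<not> v x \<longrightarrow> v(x := True) \<in> D \<longrightarrow> f v \<longrightarrow> f (v(x := True)))"

lemma encode_TBit:
  "i \<in> agents S \<Longrightarrow> l \<in> local_states S i \<Longrightarrow> a \<in> local_actions S i \<Longrightarrow>
    encode S M (TBit i l a) \<longleftrightarrow> a \<in> protocol M i l"
  by (auto simp: encode_def model_vars_def TB_def)

lemma encode_VBit:
  "g \<in> global_states S \<Longrightarrow> p \<in> prop_vars S \<Longrightarrow> encode S M (VBit g p) \<longleftrightarrow> p \<in> valuation M g"
  by (auto simp: encode_def model_vars_def VB_def)

lemma inj_on_encode: "inj_on (encode S) (models S)"
proof (rule inj_onI)
  fix M N assume M: "M \<in> models S" and N: "N \<in> models S" and eq: "encode S M = encode S N"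
  have "protocol M i = protocol N i" if i: "i \<in> agents S" for i
  proof (rule PiE_ext)
    show PM: "protocol M i \<in> (\<Pi>\<^sub>E l\<in>local_states S i. Pow (local_actions S i) - {{}})"
      and PN: "protocol N i \<in> (\<Pi>\<^sub>E l\<in>local_states S i. Pow (local_actions S i) - {{}})"
      using M N i by (simp_all add: models_def PiE_iff)
    fix l assume l: "l \<in> local_states S i"
    have "protocol M i l \<subseteq> local_actions S i" "protocol N i l \<subseteq> local_actions S i"
      using PiE_mem[OF PM l] PiE_mem[OF PN l] by auto
    moreover have "a \<in> protocol M i l \<longleftrightarrow> a \<in> protocol N i l" if "a \<in> local_actions S i" for a
      using encode_TBit[OF i l that, of M] encode_TBit[OF i l that, of N] eq by simp
    ultimately show "protocol M i l = protocol N i l" by blast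
  qed
  then have 1: "protocol M = protocol N"
    using M N by (auto simp: models_def intro: PiE_ext)
  have 2: "valuation M = valuation N"
  proof (rule PiE_ext)
    show VM: "valuation M \<in> global_states S \<rightarrow>\<^sub>E Pow (prop_vars S)"
      and VN: "valuation N \<in> global_states S \<rightarrow>\<^sub>E Pow (prop_vars S)"
      using M N by (auto simp: models_def)
    fix g assume g: "g \<in> global_states S"
    have "valuation M g \<subseteq> prop_vars S" "valuation N g \<subseteq> prop_vars S"
      using PiE_mem[OF VM g] PiE_mem[OF VN g] by auto
    moreover have "p \<in> valuation M g \<longleftrightarrow> p \<in> valuation N g" if "p \<in> prop_vars S" for p
      using encode_VBit[OF g that, of M] encode_VBit[OF g that, of N] eq by simp
    ultimately show "valuation M g = valuation N g" by blast
  qed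
  show "M = N" using 1 2 by simp
qed

lemma model_of_encode: "M \<in> models S \<Longrightarrow> model_of S (encode S M) = M"
  unfolding model_of_def using inj_on_encode[of S] by (auto dest: inj_onD)

lemma encode_set_VBit:
  assumes "M \<in> models S" "g \<in> global_states S" "p \<in> prop_vars S"
  shows "(encode S M)(VBit g p := True) =
    encode S (M\<lparr>valuation := (valuation M)(g := insert p (valuation M g))\<rparr>)"
proof (rule ext)
  fix x
  have "VBit g p \<in> model_vars S"
    using assms by (auto simp: model_vars_def VB_def)
  then show "((encode S M)(VBit g p := True)) x =
      encode S (M\<lparr>valuation := (valuation M)(g := insert p (valuation M g))\<rparr>) x"
    by (cases x) (simp_all add: encode_def)
qed

text \<open>Consequently the premise \<open>v(x := True) \<in> D\<close> of monotonicity is vacuous for \<open>x \<in> VB S\<close>.\<close>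

lemma model_vectors_set_VB:
  assumes "v \<in> model_vectors S" "x \<in> VB S"
  shows "v(x := True) \<in> model_vectors S"
proof -
  obtain M where M: "M \<in> models S" "v = encode S M"
    using assms by (auto simp: model_vectors_def)
  obtain g p where x: "x = VBit g p" "g \<in> global_states S" "p \<in> prop_vars S"
    using assms by (auto simp: VB_def)
  have "valuation M \<in> global_states S \<rightarrow>\<^sub>E Pow (prop_vars S)"
    using M by (simp add: models_def)
  then have "(valuation M)(g := insert p (valuation M g)) \<in> global_states S \<rightarrow>\<^sub>E Pow (prop_vars S)"
    using x by (auto simp: PiE_iff extensional_def)
  then have "M\<lparr>valuation := (valuation M)(g := insert p (valuation M g))\<rparr> \<in> models S"
    using M by (simp add: models_def)
  then show ?thesis
    using encode_set_VBit[OF M(1) x(2,3)] M x by (auto simp: model_vectors_def)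
qed

end

theory Submission
  imports Defs
begin

text \<open>
  Strategies and outcomes depend on the model only through its protocols. Hence enlarging the
  valuation while keeping the protocols preserves the truth of every formula without negation,
  with the same strategies as witnesses.
\<close>

text \<open>A class closed under subformulas, as the induction requires.\<close>

primrec negation_free :: "'p atl \<Rightarrow> bool" where
  "negation_free (Prop p) \<longleftrightarrow> True"
| "negation_free (Neg \<phi>) \<longleftrightarrow> False"
| "negation_free (Conj \<phi> \<psi>) \<longleftrightarrow> negation_free \<phi> \<and> negation_free \<psi>"
| "negation_free (CoalX \<Gamma> \<phi>) \<longleftrightarrow> negation_free \<phi>"
| "negation_free (CoalU \<Gamma> \<phi> \<psi>) \<longleftrightarrow> negation_free \<phi> \<and> negation_free \<psi>"
| "negation_free (CoalG \<Gamma> \<phi>) \<longleftrightarrow> negation_free \<phi>"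

lemma joint_strategies_cong_protocol:
  "protocol M = protocol N \<Longrightarrow> joint_strategies S M \<Gamma> = joint_strategies S N \<Gamma>"
  by (simp add: joint_strategies_def)

lemma outcome_cong_protocol:
  "protocol M = protocol N \<Longrightarrow> outcome S M g \<Gamma> \<sigma> = outcome S N g \<Gamma> \<sigma>"
  by (simp add: outcome_def path_from_def global_trans_def local_trans_def)

lemma sat_mono_valuation:
  assumes "protocol M = protocol N" and "\<And>g. valuation M g \<subseteq> valuation N g"
  shows "negation_free \<phi> \<Longrightarrow> sat S M g \<phi> \<Longrightarrow> sat S N g \<phi>"
\<comment> \<open>The state must vary: in the coalition cases the induction hypothesis is used at
  the states visited by the paths of an outcome, not at \<open>g\<close>.\<close>
proof (induction \<phi> arbitrary: g)
  case (Prop p)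
  then show ?case using assms(2) by auto
next
  case (CoalX \<Gamma> \<phi>)
  then show ?case
    by (simp add: joint_strategies_cong_protocol[OF assms(1)] outcome_cong_protocol[OF assms(1)])
       meson
next
  case (CoalU \<Gamma> \<phi> \<psi>)
  then show ?case
    by (simp add: joint_strategies_cong_protocol[OF assms(1)] outcome_cong_protocol[OF assms(1)])
       meson
next
  case (CoalG \<Gamma> \<phi>)
  then show ?case
    by (simp add: joint_strategies_cong_protocol[OF assms(1)] outcome_cong_protocol[OF assms(1)])
       meson
qed auto

text \<open>Updating at a global state keeps the valuation extensional, so the result is again a
  model and \<open>model_of\<close> decodes its encoding.\<close>

lemma models_insert_valuation:
  assumes "M \<in> models S" "g \<in> global_states S" "p \<in> prop_vars S"
  shows "M\<lparr>valuation := (valuation M)(g := insert p (valuation M g))\<rparr> \<in> models S"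
  using assms by (auto simp: models_def PiE_iff extensional_def)

text \<open>Raising one bit of \<open>VB\<close> encodes adding one proposition at one state, so
  bitwise monotonicity reduces to \<open>sat_mono_valuation\<close> after decoding both
  vectors.\<close>

lemma positive_monotonic_Model_VB:
  assumes "negation_free \<phi>"
  shows "positive_monotonic (model_vectors S) (VB S) (Model S g \<phi>)"
  unfolding positive_monotonic_def
proof (intro ballI impI)
  fix v x
  assume "v \<in> model_vectors S" "x \<in> VB S" and sat: "Model S g \<phi> v"
  then obtain M h r where M: "M \<in> models S" "v = encode S M"
    and x: "x = VBit h r" "h \<in> global_states S" "r \<in> prop_vars S"
    by (auto simp: model_vectors_def VB_def)
  define N where "N = M\<lparr>valuation := (valuation M)(h := insert r (valuation M h))\<rparr>"
  have "N \<in> models S"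
    unfolding N_def using M(1) x(2,3) by (rule models_insert_valuation)
  moreover have "v(x := True) = encode S N"
    unfolding N_def M(2) x(1) using M(1) x(2,3) by (rule encode_set_VBit)
  ultimately have "model_of S (v(x := True)) = N"
    by (simp add: model_of_encode)
  moreover have "sat S M g \<phi>"
    using sat M by (simp add: Model_def model_of_encode)
  then have "sat S N g \<phi>"
    \<comment> \<open>The rotation puts the satisfaction premise first, so that the chained fact
      fixes \<open>M\<close>.\<close>
    by (rule sat_mono_valuation[rotated 3]) (auto simp: N_def assms)
  ultimately show "Model S g \<phi> (v(x := True))"
    by (simp add: Model_def)
qed

theorem theorem3p3:
  fixes S :: "'p signature" and g :: gstate and p q :: 'p and \<Gamma> :: "nat set" and \<phi> :: "'p atl"
  assumes "finite (prop_vars S)"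
    and "g \<in> global_states S"
    and "p \<in> prop_vars S" and "q \<in> prop_vars S"
    and "\<Gamma> \<subseteq> agents S"
    and "\<phi> \<in> {Prop p, Conj (Prop p) (Prop q), CoalX \<Gamma> (Prop p), CoalG \<Gamma> (Prop p),
               CoalU \<Gamma> (Prop p) (Prop q)}"
  shows "positive_monotonic (model_vectors S) (VB S) (Model S g \<phi>)"
  \<comment> \<open>None of the five formulas contains \<open>Neg\<close>.\<close>
  using assms(6) by (intro positive_monotonic_Model_VB) auto

end
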